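(* Let $(\mathbb{R}^2,\mu)$ be a KV-algebra with structure constants $\Gamma_{ij}^k$. Then: (i) $\operatorname{Im}\delta^{-1}=\{0\}$. (ii) $\operatorname{Im}\delta^{0}$ is the set of linear maps $g:\mathbb{R}^2\to\mathbb{R}^2$ with matrix $\begin{pmatrix} u_{11} & u_{12} \\ u_{21} & u_{22} \end{pmatrix}$ satisfying, for some $\xi=(\xi_1,\xi_2)\in J(\mathbb{R}^2)$, $$\begin{cases}(\Gamma_{21}^{1}-\Gamma_{12}^{1})\xi_{2}=u_{11}\\ (\Gamma_{12}^{1}-\Gamma_{21}^{1})\xi_{1}=u_{12}\\ (\Gamma_{21}^{2}-\Gamma_{12}^{2})\xi_{2}=u_{21}\\ (\Gamma_{12}^{2}-\Gamma_{21}^{2})\xi_{1}=u_{22}.\end{cases}$$ (iii) $\operatorname{Im}\delta^{1}$ is the set of bilinear maps $g:\mathbb{R}^2\times\mathbb{R}^2\to\mathbb{R}^2$ with matrices $\left(\begin{pmatrix} u_{11} & u_{12} \\ u_{21} & u_{22} \end{pmatrix},\begin{pmatrix} v_{11} & v_{12} \\ v_{21} & v_{22} \end{pmatrix}\right)$ satisfying, for some $\alpha,\beta,\gamma,\lambda\in\mathbb{R}$, $$\begin{cases} -\Gamma_{11}^{1}\alpha+\Gamma_{11}^{2}\beta-(\Gamma_{12}^{1}+\Gamma_{21}^{1})\gamma=u_{11}\\ (\Gamma_{12}^{2}-\Gamma_{11}^{1})\beta-\Gamma_{22}^{1}\gamma-\Gamma_{12}^{1}\lambda=u_{12}\\ (\Gamma_{11}^{2}-\Gamma_{11}^{1})\beta-\Gamma_{22}^{1}\gamma-\Gamma_{21}^{1}\lambda=u_{21}\\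 \Gamma_{22}^{1}\alpha+(\Gamma_{22}^{2}-\Gamma_{12}^{1}-\Gamma_{21}^{1})\beta-2\Gamma_{22}^{1}\lambda=u_{22}\\ -2\Gamma_{11}^{2}\alpha+(\Gamma_{11}^{1}-\Gamma_{12}^{2}-\Gamma_{21}^{2})\gamma+\Gamma_{11}^{2}\lambda=v_{11}\\ -\Gamma_{12}^{2}\alpha-\Gamma_{11}^{2}\beta+(\Gamma_{12}^{1}-\Gamma_{22}^{2})\gamma=v_{12}\\ -\Gamma_{21}^{2}\alpha-\Gamma_{11}^{2}\beta+(\Gamma_{21}^{1}-\Gamma_{22}^{2})\gamma=v_{21}\\ -(\Gamma_{21}^{2}+\Gamma_{12}^{2})\beta+\Gamma_{22}^{1}\gamma-\Gamma_{22}^{2}\lambda=v_{22}. \end{cases}$$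
   Context: Fix a basis $(e_1,e_2)$ of $\mathbb{R}^2$. A bilinear map $\mu:\mathbb{R}^2\times\mathbb{R}^2\to\mathbb{R}^2$, also written $uv=\mu(u,v)$, is identified with the pair of matrices $\Gamma_1=(\Gamma_{ij}^1)$, $\Gamma_2=(\Gamma_{ij}^2)$ by $\mu(u,v)=(u^t\Gamma_1v,\,u^t\Gamma_2v)$, i.e. $\mu(e_i,e_j)=\Gamma_{ij}^1e_1+\Gamma_{ij}^2e_2$. Put $Ass_\mu(u,v,w)=(uv)w-u(vw)$. $(\mathbb{R}^2,\mu)$ is a KV-algebra (Koszul-Vinberg algebra) if $Ass_\mu(u,v,w)=Ass_\mu(v,u,w)$ for all $u,v,w$. The KV-complex is $0\xrightarrow{\delta^{-1}}C^0(\mathbb{R}^2)\xrightarrow{\delta^0}C^1(\mathbb{R}^2)\xrightarrow{\delta^1}C^2(\mathbb{R}^2)\to\cdots$, where $C^0(\mathbb{R}^2)=J(\mathbb{R}^2)=\{\xi\in\mathbb{R}^2: Ass_\mu(u,v,\xi)=0\ \forall u,v\in\mathbb{R}^2\}$, and for $q\ge1$, $C^q(\mathbb{R}^2)$ is the space of $q$-linear maps $(\mathbb{R}^2)^q\to\mathbb{R}^2$. The coboundaries are $\delta^0(\xi)(u)=-u\xi+\xi u$ and $\delta^1f(u,v)=-u f(v)+f(uv)-f(u)v$; in (iii), $\alpha,\beta,\gamma,\lambda$ are the entries of the matrix $\begin{pmatrix}\alpha&\beta\\ \gamma&\lambda\end{pmatrix}$ of a linear map $f_1(x,y)=(\alpha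 x+\beta y,\gamma x+\lambda y)$ with $\delta^1f_1=g$. A linear map with matrix $\begin{pmatrix} u_{11} & u_{12} \\ u_{21} & u_{22} \end{pmatrix}$ is $g(x,y)=(u_{11}x+u_{12}y,\,u_{21}x+u_{22}y)$. A bilinear map with matrices $(U,V)$ is $g(u,v)=(u^tUv,u^tVv)$.
   Formalization: In (iii), the coefficient of β in the equation for u_21 is corrected from Γ_11^2 − Γ_11^1 to Γ_21^2 − Γ_11^1; the printed one fails for the KV-algebra e1e1=e1, e1e2=e2e1=e2, e2e2=0. *)

theory Defs
  imports "HOL-Analysis.Analysis"
begin

definition is_basis :: "real^2 \<Rightarrow> real^2 \<Rightarrow> bool" where
  "is_basis e1 e2 \<longleftrightarrow> e1 \<noteq> e2 \<and> independent {e1, e2} \<and> span {e1, e2} = UNIV"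

text \<open>
  The pair \<open>(x, y)\<close> denotes the vector with these coordinates in the basis \<open>(e1, e2)\<close>, so
  all matrices below are taken with respect to that basis. For the standard basis
  \<^term>\<open>comb\<close> is the identity.
\<close>

definition comb :: "real^2 \<Rightarrow> real^2 \<Rightarrow> real^2 \<Rightarrow> real^2" where
  "comb e1 e2 c = c $ 1 *\<^sub>R e1 + c $ 2 *\<^sub>R e2"

text \<open>In a matrix \<open>U\<close>, the entry in row \<open>i\<close> and column \<open>j\<close> is \<open>U $ i $ j\<close>.\<close>

definition linear_matrix :: "real^2 \<Rightarrow> real^2 \<Rightarrow> (real^2 \<Rightarrow> real^2) \<Rightarrow> real^2^2 \<Rightarrow> bool" where
  "linear_matrix e1 e2 g U \<longleftrightarrow> (\<forall>c. g (comb e1 e2 c) = comb e1 e2 (U *v c))"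

text \<open>Here \<open>a \<bullet> (U *v b)\<close> is the product of the row \<open>a\<close>, the matrix \<open>U\<close> and the column \<open>b\<close>.\<close>

definition bilinear_matrices ::
    "real^2 \<Rightarrow> real^2 \<Rightarrow> (real^2 \<Rightarrow> real^2 \<Rightarrow> real^2) \<Rightarrow> real^2^2 \<Rightarrow> real^2^2 \<Rightarrow> bool" where
  "bilinear_matrices e1 e2 g U V \<longleftrightarrow>
     (\<forall>a b. g (comb e1 e2 a) (comb e1 e2 b) = comb e1 e2 (vector [a \<bullet> (U *v b), a \<bullet> (V *v b)]))"

definition Ass :: "('a \<Rightarrow> 'a \<Rightarrow> 'a::ab_group_add) \<Rightarrow> 'a \<Rightarrow> 'a \<Rightarrow> 'a \<Rightarrow> 'a" where
  "Ass \<mu> u v w = \<mu> (\<mu> u v) w - \<mu> u (\<mu> v w)"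

definition KV_algebra :: "(real^2 \<Rightarrow> real^2 \<Rightarrow> real^2) \<Rightarrow> bool" where
  "KV_algebra \<mu> \<longleftrightarrow> bilinear \<mu> \<and> (\<forall>u v w. Ass \<mu> u v w = Ass \<mu> v u w)"

definition J :: "(real^2 \<Rightarrow> real^2 \<Rightarrow> real^2) \<Rightarrow> (real^2) set" where
  "J \<mu> = {\<xi>. \<forall>u v. Ass \<mu> u v \<xi> = 0}"

text \<open>The zero space at the start of the complex is taken to be the zero subspace of the plane.\<close>

definition Czero :: "(real^2) set" where
  "Czero = {0}"

definition C0 :: "(real^2 \<Rightarrow> real^2 \<Rightarrow> real^2) \<Rightarrow> (real^2) set" where
  "C0 \<mu> = J \<mu>"

definition C1 :: "(real^2 \<Rightarrow> real^2) set" where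
  "C1 = {f. linear f}"

definition C2 :: "(real^2 \<Rightarrow> real^2 \<Rightarrow> real^2) set" where
  "C2 = {g. bilinear g}"

definition delta_minus1 :: "real^2 \<Rightarrow> real^2" where
  "delta_minus1 z = 0"

definition delta0 :: "(real^2 \<Rightarrow> real^2 \<Rightarrow> real^2) \<Rightarrow> real^2 \<Rightarrow> (real^2 \<Rightarrow> real^2)" where
  "delta0 \<mu> \<xi> = (\<lambda>u. - \<mu> u \<xi> + \<mu> \<xi> u)"

definition delta1 ::
    "(real^2 \<Rightarrow> real^2 \<Rightarrow> real^2) \<Rightarrow> (real^2 \<Rightarrow> real^2) \<Rightarrow> (real^2 \<Rightarrow> real^2 \<Rightarrow> real^2)" where
  "delta1 \<mu> f = (\<lambda>u v. - \<mu> u (f v) + f (\<mu> u v) - \<mu> (f u) v)"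

end

theory Submission
  imports Defs
begin

text \<open>
  Coordinates in the basis identify the plane with itself, so a map is determined by its
  matrices. Writing \<open>M\<close> for the matrix of \<open>f\<close>, the coboundary of \<open>f\<close> has the matrices
  \<open>M\<^sub>k\<^sub>1 \<Gamma>\<^sub>1 + M\<^sub>k\<^sub>2 \<Gamma>\<^sub>2 - \<Gamma>\<^sub>k M - M\<^sup>T \<Gamma>\<^sub>k\<close>, and the rows of the matrix of the coboundary of \<open>\<xi>\<close> are
  \<open>\<xi>\<^sup>T (\<Gamma>\<^sub>k - \<Gamma>\<^sub>k\<^sup>T)\<close>. The systems in the theorem are the entries of these matrices.
\<close>

lemma linear_comb: "linear (comb e1 e2)"
  by (rule linearI) (simp_all add: comb_def algebra_simps)

lemma vec2_eqI: "x $ 1 = y $ 1 \<Longrightarrow> x $ 2 = y $ 2 \<Longrightarrow> x = (y :: 'a^2)"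
  by (simp add: vec_eq_iff forall_2)

text \<open>Makes it enough to compare maps on vectors written in coordinates.\<close>

lemma comb_surj:
  assumes "is_basis e1 e2"
  shows "\<exists>c. x = comb e1 e2 c"
proof -
  have "x \<in> span {e1, e2}"
    using assms by (simp add: is_basis_def)
  then obtain a b where "x = a *\<^sub>R e1 + b *\<^sub>R e2"
    by (auto simp: span_insert span_singleton algebra_simps)
  then have "x = comb e1 e2 (vector [a, b])"
    by (simp add: comb_def)
  then show ?thesis ..
qed

text \<open>Provides the coordinate map \<open>h\<close>. A surjective linear endomorphism of a
  finite-dimensional space is injective and so has a linear left inverse; surjectivity then makes
  the inverse two-sided.\<close>

lemma comb_linear_inverse:
  assumes "is_basis e1 e2"
  obtains h where "linear h" "\<And>c. h (comb e1 e2 c) = c" "\<And>x. comb e1 e2 (h x) = x"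
proof -
  have "surj (comb e1 e2)"
    using comb_surj[OF assms] by (auto simp: surj_def)
  then have "inj (comb e1 e2)"
    \<comment> \<open>Here \<open>refl\<close> settles the equality of the dimensions of source and
      target.\<close>
    by (rule linear_surjective_imp_injective[OF linear_comb _ refl])
  then obtain h where h: "linear h" "h \<circ> comb e1 e2 = id"
    using linear_injective_left_inverse[OF linear_comb] by blast
  then have "h (comb e1 e2 c) = c" for c
    by (simp add: pointfree_idE)
  moreover from this have "comb e1 e2 (h x) = x" for x
    using comb_surj[OF assms, of x] by auto
  ultimately show thesis
    using h that by blast
qed

text \<open>Conjugating \<open>f\<close> with the coordinate map gives a linear map on coordinate
  vectors, whose standard matrix is \<open>M\<close>. The entries of \<open>M\<close> serve as the
  unknowns of the system for \<open>delta1\<close>.\<close>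

lemma ex_matrix_of_linear:
  assumes "is_basis e1 e2" "linear f"
  obtains M where "linear_matrix e1 e2 f M"
proof -
  obtain h where h: "linear h" "\<And>x. comb e1 e2 (h x) = x"
    by (rule comb_linear_inverse[OF assms(1)]) blast
  have "linear (h \<circ> (f \<circ> comb e1 e2))"
    by (intro linear_compose linear_comb assms h)
  then have "linear_matrix e1 e2 f (matrix (h \<circ> (f \<circ> comb e1 e2)))"
    by (simp add: linear_matrix_def matrix_works h)
  then show thesis
    by (rule that)
qed

text \<open>Conjugation in the other direction. It turns a solution of the system for
  \<open>delta1\<close> back into a cochain.\<close>

lemma ex_linear_of_matrix:
  assumes "is_basis e1 e2"
  obtains f where "linear f" "linear_matrix e1 e2 f M"
proof -
  obtain h where h: "linear h" "\<And>c. h (comb e1 e2 c) = c"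
    by (rule comb_linear_inverse[OF assms]) blast
  have "linear (comb e1 e2 \<circ> ((*v) M \<circ> h))"
    by (intro linear_compose linear_comb h matrix_vector_mul_linear)
  moreover have "linear_matrix e1 e2 (comb e1 e2 \<circ> ((*v) M \<circ> h)) M"
    by (simp add: linear_matrix_def h)
  ultimately show thesis
    by (rule that)
qed

text \<open>Together with its bilinear counterpart, this reduces the inclusions of the solution sets
  in the images to equalities of matrices.\<close>

lemma linear_matrix_unique:
  assumes "is_basis e1 e2" "linear_matrix e1 e2 f M" "linear_matrix e1 e2 g M"
  shows "f = g"
proof
  fix x show "f x = g x"
    using comb_surj[OF assms(1), of x] assms(2,3) by (auto simp: linear_matrix_def)
qed

lemma bilinear_matrices_unique:
  assumes "is_basis e1 e2" "bilinear_matrices e1 e2 f U V" "bilinear_matrices e1 e2 g U V"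
  shows "f = g"
proof (intro ext)
  fix x y show "f x y = g x y"
    using comb_surj[OF assms(1), of x] comb_surj[OF assms(1), of y] assms(2,3)
    by (auto simp: bilinear_matrices_def)
qed

lemma linear_delta0:
  assumes "bilinear \<mu>"
  shows "linear (delta0 \<mu> \<xi>)"
  using assms unfolding delta0_def bilinear_def
  by (intro linear_compose_add linear_compose_neg) auto

lemma bilinear_delta1:
  assumes "bilinear \<mu>" "linear f"
  shows "bilinear (delta1 \<mu> f)"
proof -
  note [simp] = bilinear_ladd[OF assms(1)] bilinear_radd[OF assms(1)]
    bilinear_lmul[OF assms(1)] bilinear_rmul[OF assms(1)]
    linear_add[OF assms(2)] linear_cmul[OF assms(2)]
  show ?thesis
    unfolding bilinear_def delta1_def
    by (auto intro!: linearI simp: algebra_simps)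
qed

text \<open>The scalar c^T \<Gamma> \<xi> equals its transpose \<xi>^T \<Gamma>^T c, so each
  component of -u\<xi> + \<xi>u is \<xi>^T (\<Gamma> - \<Gamma>^T) c, where c holds the coordinates
  of u. An antisymmetric matrix has zero diagonal, which leaves a single coordinate of \<xi> in
  every entry.\<close>

lemma linear_matrix_delta0:
  assumes "bilinear_matrices e1 e2 \<mu> \<Gamma>1 \<Gamma>2"
  shows "linear_matrix e1 e2 (delta0 \<mu> (comb e1 e2 \<xi>))
    (vector [\<xi> v* (\<Gamma>1 - transpose \<Gamma>1), \<xi> v* (\<Gamma>2 - transpose \<Gamma>2)])"
  unfolding linear_matrix_def
proof
  fix c
  have "delta0 \<mu> (comb e1 e2 \<xi>) (comb e1 e2 c) =
      comb e1 e2 (- vector [c \<bullet> (\<Gamma>1 *v \<xi>), c \<bullet> (\<Gamma>2 *v \<xi>)] + vector [\<xi> \<bullet> (\<Gamma>1 *v c), \<xi> \<bullet> (\<Gamma>2 *v c)])"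
    using assms
    by (simp add: delta0_def bilinear_matrices_def linear_add[OF linear_comb] linear_diff[OF linear_comb])
  also have "\<dots> = comb e1 e2
      (vector [\<xi> v* (\<Gamma>1 - transpose \<Gamma>1), \<xi> v* (\<Gamma>2 - transpose \<Gamma>2)] *v c)"
    by (rule arg_cong[where f = "comb e1 e2"], rule vec2_eqI)
      (simp_all add: inner_vec_def sum_2 matrix_vector_mult_def vector_matrix_mult_def
        transpose_def algebra_simps)
  finally show "delta0 \<mu> (comb e1 e2 \<xi>) (comb e1 e2 c) = \<dots>" .
qed

text \<open>For u, v with coordinates \<open>a\<close>, \<open>b\<close>: f(uv) mixes both structure
  matrices through a row of \<open>M\<close>, u f(v) multiplies \<Gamma> by \<open>M\<close> on the
  right, and f(u) v multiplies it by the transpose on the left, since (M a)^T = a^T M^T.\<close>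

lemma bilinear_matrices_delta1:
  assumes "bilinear_matrices e1 e2 \<mu> \<Gamma>1 \<Gamma>2" "linear_matrix e1 e2 f M"
  shows "bilinear_matrices e1 e2 (delta1 \<mu> f)
    (M $ 1 $ 1 *\<^sub>R \<Gamma>1 + M $ 1 $ 2 *\<^sub>R \<Gamma>2 - \<Gamma>1 ** M - transpose M ** \<Gamma>1)
    (M $ 2 $ 1 *\<^sub>R \<Gamma>1 + M $ 2 $ 2 *\<^sub>R \<Gamma>2 - \<Gamma>2 ** M - transpose M ** \<Gamma>2)"
    (is "bilinear_matrices _ _ _ ?U ?V")
  unfolding bilinear_matrices_def
proof (intro allI)
  fix a b
  \<comment> \<open>The three vectors are the coordinates of f(uv), u f(v) and f(u) v, in this
    order.\<close>
  have "delta1 \<mu> f (comb e1 e2 a) (comb e1 e2 b) = comb e1 e2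
      (M *v vector [a \<bullet> (\<Gamma>1 *v b), a \<bullet> (\<Gamma>2 *v b)]
        - vector [a \<bullet> (\<Gamma>1 *v (M *v b)), a \<bullet> (\<Gamma>2 *v (M *v b))]
        - vector [(M *v a) \<bullet> (\<Gamma>1 *v b), (M *v a) \<bullet> (\<Gamma>2 *v b)])"
    using assms
    by (simp add: delta1_def bilinear_matrices_def linear_matrix_def linear_diff[OF linear_comb])
  also have "\<dots> = comb e1 e2 (vector [a \<bullet> (?U *v b), a \<bullet> (?V *v b)])"
    by (rule arg_cong[where f = "comb e1 e2"], rule vec2_eqI)
      (simp_all add: inner_vec_def sum_2 matrix_vector_mult_def matrix_matrix_mult_def
        transpose_def algebra_simps)
  finally show "delta1 \<mu> f (comb e1 e2 a) (comb e1 e2 b) = \<dots>" .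
qed

theorem theorem4:
  fixes \<mu> :: "real^2 \<Rightarrow> real^2 \<Rightarrow> real^2"
    and e1 e2 :: "real^2"
    and \<Gamma>1 \<Gamma>2 :: "real^2^2"
  assumes basis: "is_basis e1 e2"
    and KV: "KV_algebra \<mu>"
    and structure_constants: "bilinear_matrices e1 e2 \<mu> \<Gamma>1 \<Gamma>2"
  shows "delta_minus1 ` Czero = {0} \<and>
    delta0 \<mu> ` C0 \<mu> =
      {g \<in> C1. \<exists>U. linear_matrix e1 e2 g U \<and>
        (\<exists>\<xi>1 \<xi>2. comb e1 e2 (vector [\<xi>1, \<xi>2]) \<in> J \<mu> \<and>
          (\<Gamma>1 $ 2 $ 1 - \<Gamma>1 $ 1 $ 2) * \<xi>2 = U $ 1 $ 1 \<and>
          (\<Gamma>1 $ 1 $ 2 - \<Gamma>1 $ 2 $ 1) * \<xi>1 = U $ 1 $ 2 \<and>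
          (\<Gamma>2 $ 2 $ 1 - \<Gamma>2 $ 1 $ 2) * \<xi>2 = U $ 2 $ 1 \<and>
          (\<Gamma>2 $ 1 $ 2 - \<Gamma>2 $ 2 $ 1) * \<xi>1 = U $ 2 $ 2)} \<and>
    delta1 \<mu> ` C1 =
      {g \<in> C2. \<exists>U V. bilinear_matrices e1 e2 g U V \<and>
        (\<exists>\<alpha> \<beta> \<gamma> lam.
          - \<Gamma>1 $ 1 $ 1 * \<alpha> + \<Gamma>2 $ 1 $ 1 * \<beta> - (\<Gamma>1 $ 1 $ 2 + \<Gamma>1 $ 2 $ 1) * \<gamma> = U $ 1 $ 1 \<and>
          (\<Gamma>2 $ 1 $ 2 - \<Gamma>1 $ 1 $ 1) * \<beta> - \<Gamma>1 $ 2 $ 2 * \<gamma> - \<Gamma>1 $ 1 $ 2 * lam = U $ 1 $ 2 \<and>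
          (\<Gamma>2 $ 2 $ 1 - \<Gamma>1 $ 1 $ 1) * \<beta> - \<Gamma>1 $ 2 $ 2 * \<gamma> - \<Gamma>1 $ 2 $ 1 * lam = U $ 2 $ 1 \<and>
          \<Gamma>1 $ 2 $ 2 * \<alpha> + (\<Gamma>2 $ 2 $ 2 - \<Gamma>1 $ 1 $ 2 - \<Gamma>1 $ 2 $ 1) * \<beta> - 2 * \<Gamma>1 $ 2 $ 2 * lam = U $ 2 $ 2 \<and>
          - 2 * \<Gamma>2 $ 1 $ 1 * \<alpha> + (\<Gamma>1 $ 1 $ 1 - \<Gamma>2 $ 1 $ 2 - \<Gamma>2 $ 2 $ 1) * \<gamma> + \<Gamma>2 $ 1 $ 1 * lam = V $ 1 $ 1 \<and>
          - \<Gamma>2 $ 1 $ 2 * \<alpha> - \<Gamma>2 $ 1 $ 1 * \<beta> + (\<Gamma>1 $ 1 $ 2 - \<Gamma>2 $ 2 $ 2) * \<gamma> = V $ 1 $ 2 \<and>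
          - \<Gamma>2 $ 2 $ 1 * \<alpha> - \<Gamma>2 $ 1 $ 1 * \<beta> + (\<Gamma>1 $ 2 $ 1 - \<Gamma>2 $ 2 $ 2) * \<gamma> = V $ 2 $ 1 \<and>
          - (\<Gamma>2 $ 2 $ 1 + \<Gamma>2 $ 1 $ 2) * \<beta> + \<Gamma>1 $ 2 $ 2 * \<gamma> - \<Gamma>2 $ 2 $ 2 * lam = V $ 2 $ 2)}"
proof (intro conjI)
  let "_ \<and> _ = ?R0 \<and> _ = ?R1" = ?thesis
  have bil: "bilinear \<mu>"
    using KV by (simp add: KV_algebra_def)
  note matrix_simps = sum_2 vector_matrix_mult_def matrix_matrix_mult_def transpose_def algebra_simps
  show "delta_minus1 ` Czero = {0}"
    by (simp add: delta_minus1_def Czero_def)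
  show "delta0 \<mu> ` C0 \<mu> = ?R0"
  proof (intro subset_antisym subsetI)
    fix g assume "g \<in> delta0 \<mu> ` C0 \<mu>"
    then obtain x where x: "x \<in> J \<mu>" "g = delta0 \<mu> x"
      by (auto simp: C0_def)
    obtain \<xi> where \<xi>: "x = comb e1 e2 \<xi>"
        using comb_surj[OF basis] ..
    \<comment> \<open>The solution set quantifies over two scalars, so \<xi> has to be reassembled
      from its coordinates.\<close>
    have \<xi>_eq: "vector [\<xi> $ 1, \<xi> $ 2] = \<xi>"
      by (simp add: vec2_eqI)
    show "g \<in> ?R0"
      unfolding mem_Collect_eq
    proof (intro conjI exI)
      show "g \<in> C1"
        using linear_delta0[OF bil] by (simp add: x C1_def)
      show "linear_matrix e1 e2 g
          (vector [\<xi> v* (\<Gamma>1 - transpose \<Gamma>1), \<xi> v* (\<Gamma>2 - transpose \<Gamma>2)])"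
        using linear_matrix_delta0[OF structure_constants] by (simp add: x \<xi>)
      show "comb e1 e2 (vector [\<xi> $ 1, \<xi> $ 2]) \<in> J \<mu>"
        using x by (simp add: \<xi>_eq \<xi>)
    qed (simp_all add: matrix_simps)
  next
    fix g assume "g \<in> ?R0"
    then obtain U \<xi>1 \<xi>2 where
      U: "linear_matrix e1 e2 g U" and
      J: "comb e1 e2 (vector [\<xi>1, \<xi>2]) \<in> J \<mu>" and
      eqs: "(\<Gamma>1 $ 2 $ 1 - \<Gamma>1 $ 1 $ 2) * \<xi>2 = U $ 1 $ 1"
        "(\<Gamma>1 $ 1 $ 2 - \<Gamma>1 $ 2 $ 1) * \<xi>1 = U $ 1 $ 2"
        "(\<Gamma>2 $ 2 $ 1 - \<Gamma>2 $ 1 $ 2) * \<xi>2 = U $ 2 $ 1"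
        "(\<Gamma>2 $ 1 $ 2 - \<Gamma>2 $ 2 $ 1) * \<xi>1 = U $ 2 $ 2"
      by blast
    let ?\<xi> = "vector [\<xi>1, \<xi>2] :: real^2"
    \<comment> \<open>The flipped equations replace the entries of \<open>U\<close> by expressions
      in \<Gamma> and \<xi>, leaving polynomial identities.\<close>
    have "vector [?\<xi> v* (\<Gamma>1 - transpose \<Gamma>1), ?\<xi> v* (\<Gamma>2 - transpose \<Gamma>2)] = U"
      by (intro vec2_eqI; simp add: matrix_simps flip: eqs)
    then have "g = delta0 \<mu> (comb e1 e2 ?\<xi>)"
      using linear_matrix_unique[OF basis U] linear_matrix_delta0[OF structure_constants, of ?\<xi>]
      by simp
    then show "g \<in> delta0 \<mu> ` C0 \<mu>"
      using J by (simp add: C0_def)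
  qed
  show "delta1 \<mu> ` C1 = ?R1"
  proof (intro subset_antisym subsetI)
    fix g assume "g \<in> delta1 \<mu> ` C1"
    then obtain f where f: "linear f" "g = delta1 \<mu> f"
      by (auto simp: C1_def)
    obtain M where M: "linear_matrix e1 e2 f M"
      using ex_matrix_of_linear[OF basis f(1)] .
    show "g \<in> ?R1"
      unfolding mem_Collect_eq
    proof (intro conjI exI)
      show "g \<in> C2"
        using bilinear_delta1[OF bil f(1)] by (simp add: f C2_def)
      show "bilinear_matrices e1 e2 g
          (M $ 1 $ 1 *\<^sub>R \<Gamma>1 + M $ 1 $ 2 *\<^sub>R \<Gamma>2 - \<Gamma>1 ** M - transpose M ** \<Gamma>1)
          (M $ 2 $ 1 *\<^sub>R \<Gamma>1 + M $ 2 $ 2 *\<^sub>R \<Gamma>2 - \<Gamma>2 ** M - transpose M ** \<Gamma>2)"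
        using bilinear_matrices_delta1[OF structure_constants M] by (simp add: f)
      \<comment> \<open>The witnesses are still open. This equation fixes \<alpha>, \<beta>,
        \<gamma> as entries of \<open>M\<close>; \<open>lam\<close> does not occur in it and is
        fixed by the next one.\<close>
      show "- \<Gamma>1 $ 1 $ 1 * M $ 1 $ 1 + \<Gamma>2 $ 1 $ 1 * M $ 1 $ 2 - (\<Gamma>1 $ 1 $ 2 + \<Gamma>1 $ 2 $ 1) * M $ 2 $ 1 =
          (M $ 1 $ 1 *\<^sub>R \<Gamma>1 + M $ 1 $ 2 *\<^sub>R \<Gamma>2 - \<Gamma>1 ** M - transpose M ** \<Gamma>1) $ 1 $ 1"
        by (simp add: matrix_simps)
      show "(\<Gamma>2 $ 1 $ 2 - \<Gamma>1 $ 1 $ 1) * M $ 1 $ 2 - \<Gamma>1 $ 2 $ 2 * M $ 2 $ 1 - \<Gamma>1 $ 1 $ 2 * M $ 2 $ 2 =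
          (M $ 1 $ 1 *\<^sub>R \<Gamma>1 + M $ 1 $ 2 *\<^sub>R \<Gamma>2 - \<Gamma>1 ** M - transpose M ** \<Gamma>1) $ 1 $ 2"
        by (simp add: matrix_simps)
    \<comment> \<open>Six entries remain, now without unknowns. In entry (2,1) of the first matrix,
      \<open>M $ 1 $ 2 *\<^sub>R \<Gamma>2\<close> contributes \<open>\<Gamma>2 $ 2 $ 1\<close> to
      the coefficient of \<beta>, mirroring \<open>\<Gamma>2 $ 1 $ 2\<close> in entry (1,2).\<close>
    qed (simp_all add: matrix_simps)
  next
    fix g assume "g \<in> ?R1"
    then obtain U V \<alpha> \<beta> \<gamma> lam where
      UV: "bilinear_matrices e1 e2 g U V" and eqs:
        "- \<Gamma>1 $ 1 $ 1 * \<alpha> + \<Gamma>2 $ 1 $ 1 * \<beta> - (\<Gamma>1 $ 1 $ 2 + \<Gamma>1 $ 2 $ 1) * \<gamma> = U $ 1 $ 1"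
        "(\<Gamma>2 $ 1 $ 2 - \<Gamma>1 $ 1 $ 1) * \<beta> - \<Gamma>1 $ 2 $ 2 * \<gamma> - \<Gamma>1 $ 1 $ 2 * lam = U $ 1 $ 2"
        "(\<Gamma>2 $ 2 $ 1 - \<Gamma>1 $ 1 $ 1) * \<beta> - \<Gamma>1 $ 2 $ 2 * \<gamma> - \<Gamma>1 $ 2 $ 1 * lam = U $ 2 $ 1"
        "\<Gamma>1 $ 2 $ 2 * \<alpha> + (\<Gamma>2 $ 2 $ 2 - \<Gamma>1 $ 1 $ 2 - \<Gamma>1 $ 2 $ 1) * \<beta> - 2 * \<Gamma>1 $ 2 $ 2 * lam = U $ 2 $ 2"
        "- 2 * \<Gamma>2 $ 1 $ 1 * \<alpha> + (\<Gamma>1 $ 1 $ 1 - \<Gamma>2 $ 1 $ 2 - \<Gamma>2 $ 2 $ 1) * \<gamma> + \<Gamma>2 $ 1 $ 1 * lam = V $ 1 $ 1"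
        "- \<Gamma>2 $ 1 $ 2 * \<alpha> - \<Gamma>2 $ 1 $ 1 * \<beta> + (\<Gamma>1 $ 1 $ 2 - \<Gamma>2 $ 2 $ 2) * \<gamma> = V $ 1 $ 2"
        "- \<Gamma>2 $ 2 $ 1 * \<alpha> - \<Gamma>2 $ 1 $ 1 * \<beta> + (\<Gamma>1 $ 2 $ 1 - \<Gamma>2 $ 2 $ 2) * \<gamma> = V $ 2 $ 1"
        "- (\<Gamma>2 $ 2 $ 1 + \<Gamma>2 $ 1 $ 2) * \<beta> + \<Gamma>1 $ 2 $ 2 * \<gamma> - \<Gamma>2 $ 2 $ 2 * lam = V $ 2 $ 2"
      by blast
    \<comment> \<open>A solution of the system, read as the matrix of f(x,y) = (\<alpha> x + \<beta>
      y, \<gamma> x + lam y), is the preimage of \<open>g\<close>.\<close>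
    define M :: "real^2^2" where "M = vector [vector [\<alpha>, \<beta>], vector [\<gamma>, lam]]"
    obtain f where f: "linear f" "linear_matrix e1 e2 f M"
      using ex_linear_of_matrix[OF basis] .
    have "M $ 1 $ 1 *\<^sub>R \<Gamma>1 + M $ 1 $ 2 *\<^sub>R \<Gamma>2 - \<Gamma>1 ** M - transpose M ** \<Gamma>1 = U"
      by (intro vec2_eqI; simp add: M_def matrix_simps flip: eqs)
    moreover have "M $ 2 $ 1 *\<^sub>R \<Gamma>1 + M $ 2 $ 2 *\<^sub>R \<Gamma>2 - \<Gamma>2 ** M - transpose M ** \<Gamma>2 = V"
      by (intro vec2_eqI; simp add: M_def matrix_simps flip: eqs)
    ultimately have "g = delta1 \<mu> f"
      using bilinear_matrices_unique[OF basis UV] bilinear_matrices_delta1[OF structure_constants f(2)]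
      by simp
    then show "g \<in> delta1 \<mu> ` C1"
      using f(1) by (simp add: C1_def)
  qed
qed

end
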